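(* For every bifibration $P\colon\mathcal{E}\to\mathcal{B}$ between small categories, the Švarc genus and the sectional number of $P$ coincide: $\mathrm{Sg}(P)=\mathrm{sc}(P)$.
   Context: All categories are small. Bifibrations. For a functor $P\colon\mathcal{E}\to\mathcal{B}$, a morphism $\phi\colon e_1\to e_2$ of $\mathcal{E}$ is Cartesian if for all $\beta\colon e\to e_2$ in $\mathcal{E}$ and $\bar\alpha\colon Pe\to Pe_1$ in $\mathcal{B}$ with $P\phi\circ\bar\alpha=P\beta$ there is a unique $\alpha\colon e\to e_1$ with $\phi\circ\alpha=\beta$ and $P\alpha=\bar\alpha$. $P$ is a fibration if for each $\bar\phi\colon b_1\to b_2$ in $\mathcal{B}$ and each object $e_2$ with $Pe_2=b_2$ there is a Cartesian $\phi\colon e_1\to e_2$ with $P\phi=\bar\phi$. $P$ is an op-fibration if $P^{\mathrm{op}}\colon\mathcal{E}^{\mathrm{op}}\to\mathcal{B}^{\mathrm{op}}$ is a fibration, and a bifibration if it is both. Homotopy. $\mathbb{I}_m$ ($m\ge0$) is the category with objects $0,\dots,m$ and non-identity arrows the zigzag $0\to1\leftarrow2\to\cdots m$. Functors $F,G\colon\mathcal{C}\to\mathcal{D}$ are homotopic, $F\simeq G$, if for some $m\ge0$ there is a functor $H\colon\mathcal{C}\times\mathbb{I}_m\to\mathcal{D}$ with $H_0=F$ and $H_m=G$, where $H_j$ is the restriction of $H$ to $\mathcal{C}\times\{j\}$. Geometric covers. For $n\ge1$ an $n$-chain in a category is a sequence of $n$ composable morphisms, and a $0$-chain is an object. A family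 $\{\mathcal{U}_0,\dots,\mathcal{U}_n\}$ of subcategories of $\mathcal{B}$ is a geometric cover of $\mathcal{B}$ if every chain in $\mathcal{B}$ belongs to some $\mathcal{U}_i$. Let $\iota_i\colon\mathcal{U}_i\hookrightarrow\mathcal{B}$ denote the inclusion. The sectional number $\mathrm{sc}(P)$ of a functor $P\colon\mathcal{E}\to\mathcal{B}$ is the least $n\ge0$ such that there is a geometric cover $\{\mathcal{U}_0,\dots,\mathcal{U}_n\}$ of $\mathcal{B}$ with functors $s_i\colon\mathcal{U}_i\to\mathcal{E}$ satisfying $P\circ s_i=\iota_i$ for all $i$. The Švarc genus $\mathrm{Sg}(P)$ is the least $n\ge0$ such that there is a geometric cover $\{\mathcal{U}_0,\dots,\mathcal{U}_n\}$ of $\mathcal{B}$ with functors $s_i\colon\mathcal{U}_i\to\mathcal{E}$ satisfying $P\circ s_i\simeq\iota_i$ for all $i$. Each is $\infty$ if no such $n$ exists. *)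

theory Defs
  imports Main "HOL-Library.Extended_Nat"
begin

text \<open>
  A small category is given by carrier sets of objects and morphisms inside arbitrary types.
  The remaining fields are total functions that are meaningful on these carriers only.
  \<open>Comp C g f\<close> is the composite ``g after f''.
\<close>

record ('o, 'm) cat =
  Obj :: "'o set"
  Mor :: "'m set"
  Dom :: "'m \<Rightarrow> 'o"
  Cod :: "'m \<Rightarrow> 'o"
  Id :: "'o \<Rightarrow> 'm"
  Comp :: "'m \<Rightarrow> 'm \<Rightarrow> 'm"

definition Hom :: "('o, 'm) cat \<Rightarrow> 'o \<Rightarrow> 'o \<Rightarrow> 'm set" where
  "Hom C x y = {f \<in> Mor C. Dom C f = x \<and> Cod C f = y}"

locale category =
  fixes C :: "('o, 'm) cat"
  assumes Dom_in: "f \<in> Mor C \<Longrightarrow> Dom C f \<in> Obj C"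
    and Cod_in: "f \<in> Mor C \<Longrightarrow> Cod C f \<in> Obj C"
    and Id_in: "x \<in> Obj C \<Longrightarrow> Id C x \<in> Hom C x x"
    and Comp_in: "\<lbrakk>f \<in> Hom C x y; g \<in> Hom C y z\<rbrakk> \<Longrightarrow> Comp C g f \<in> Hom C x z"
    and Comp_Id_right: "f \<in> Hom C x y \<Longrightarrow> Comp C f (Id C x) = f"
    and Comp_Id_left: "f \<in> Hom C x y \<Longrightarrow> Comp C (Id C y) f = f"
    and Comp_assoc: "\<lbrakk>f \<in> Hom C w x; g \<in> Hom C x y; h \<in> Hom C y z\<rbrakk>
      \<Longrightarrow> Comp C h (Comp C g f) = Comp C (Comp C h g) f"

record ('o, 'm, 'p, 'n) cat_map =
  fobj :: "'o \<Rightarrow> 'p"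
  fmor :: "'m \<Rightarrow> 'n"

locale cat_functor = source: category C + target: category D
  for C :: "('o, 'm) cat" and D :: "('p, 'n) cat" +
  fixes F :: "('o, 'm, 'p, 'n) cat_map"
  assumes fobj_in: "x \<in> Obj C \<Longrightarrow> fobj F x \<in> Obj D"
    and fmor_in: "f \<in> Hom C x y \<Longrightarrow> fmor F f \<in> Hom D (fobj F x) (fobj F y)"
    and fmor_Id: "x \<in> Obj C \<Longrightarrow> fmor F (Id C x) = Id D (fobj F x)"
    and fmor_Comp: "\<lbrakk>f \<in> Hom C x y; g \<in> Hom C y z\<rbrakk>
      \<Longrightarrow> fmor F (Comp C g f) = Comp D (fmor F g) (fmor F f)"

text \<open>
  Equality of functors with domain \<open>C\<close>: the values outside the carriers of \<open>C\<close> are ignored.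
\<close>

definition functor_eq ::
  "('o, 'm) cat \<Rightarrow> ('o, 'm, 'p, 'n) cat_map \<Rightarrow> ('o, 'm, 'p, 'n) cat_map \<Rightarrow> bool" where
  "functor_eq C F G \<longleftrightarrow>
     (\<forall>x\<in>Obj C. fobj F x = fobj G x) \<and> (\<forall>f\<in>Mor C. fmor F f = fmor G f)"

definition functor_comp ::
  "('p, 'n, 'q, 'k) cat_map \<Rightarrow> ('o, 'm, 'p, 'n) cat_map \<Rightarrow> ('o, 'm, 'q, 'k) cat_map" where
  "functor_comp G F = \<lparr>fobj = fobj G \<circ> fobj F, fmor = fmor G \<circ> fmor F\<rparr>"

definition opposite :: "('o, 'm) cat \<Rightarrow> ('o, 'm) cat" where
  "opposite C = \<lparr>Obj = Obj C, Mor = Mor C, Dom = Cod C, Cod = Dom C, Id = Id C,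
     Comp = (\<lambda>g f. Comp C f g)\<rparr>"

definition product_cat ::
  "('o, 'm) cat \<Rightarrow> ('p, 'n) cat \<Rightarrow> ('o \<times> 'p, 'm \<times> 'n) cat" where
  "product_cat C D = \<lparr>Obj = Obj C \<times> Obj D, Mor = Mor C \<times> Mor D,
     Dom = map_prod (Dom C) (Dom D), Cod = map_prod (Cod C) (Cod D),
     Id = map_prod (Id C) (Id D),
     Comp = (\<lambda>g f. (Comp C (fst g) (fst f), Comp D (snd g) (snd f)))\<rparr>"


subsection \<open>Bifibrations\<close>

definition cartesian ::
  "('e, 'f) cat \<Rightarrow> ('b, 'g) cat \<Rightarrow> ('e, 'f, 'b, 'g) cat_map \<Rightarrow> 'f \<Rightarrow> bool" where
  "cartesian E B P \<phi> \<longleftrightarrow> \<phi> \<in> Mor E \<and>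
     (\<forall>e\<in>Obj E. \<forall>\<beta>\<in>Hom E e (Cod E \<phi>).
      \<forall>a\<in>Hom B (fobj P e) (fobj P (Dom E \<phi>)).
        Comp B (fmor P \<phi>) a = fmor P \<beta> \<longrightarrow>
        (\<exists>!\<alpha>. \<alpha> \<in> Hom E e (Dom E \<phi>) \<and> Comp E \<phi> \<alpha> = \<beta> \<and> fmor P \<alpha> = a))"

definition fibration ::
  "('e, 'f) cat \<Rightarrow> ('b, 'g) cat \<Rightarrow> ('e, 'f, 'b, 'g) cat_map \<Rightarrow> bool" where
  "fibration E B P \<longleftrightarrow> cat_functor E B P \<and>
     (\<forall>b\<^sub>1\<in>Obj B. \<forall>b\<^sub>2\<in>Obj B. \<forall>f\<in>Hom B b\<^sub>1 b\<^sub>2. \<forall>e\<^sub>2\<in>Obj E. fobj P e\<^sub>2 = b\<^sub>2 \<longrightarrow>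
        (\<exists>e\<^sub>1\<in>Obj E. \<exists>\<phi>\<in>Hom E e\<^sub>1 e\<^sub>2. cartesian E B P \<phi> \<and> fmor P \<phi> = f))"

definition op_fibration ::
  "('e, 'f) cat \<Rightarrow> ('b, 'g) cat \<Rightarrow> ('e, 'f, 'b, 'g) cat_map \<Rightarrow> bool" where
  "op_fibration E B P \<longleftrightarrow> fibration (opposite E) (opposite B) P"

definition bifibration ::
  "('e, 'f) cat \<Rightarrow> ('b, 'g) cat \<Rightarrow> ('e, 'f, 'b, 'g) cat_map \<Rightarrow> bool" where
  "bifibration E B P \<longleftrightarrow> cat_functor E B P \<and> fibration E B P \<and> op_fibration E B P"


subsection \<open>Homotopy of functors\<close>

text \<open>
  The category with objects \<open>0, \<dots>, m\<close> and non-identity arrows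
  \<open>0 \<rightarrow> 1 \<leftarrow> 2 \<rightarrow> \<dots> m\<close>. The pair \<open>(i, j)\<close> encodes the unique arrow \<open>i \<rightarrow> j\<close>; the
  non-identity arrows lead from an even number to its odd neighbours.
\<close>

definition zigzag :: "nat \<Rightarrow> (nat, nat \<times> nat) cat" where
  "zigzag m = \<lparr>Obj = {0..m},
     Mor = {(i, j). i \<le> m \<and> j \<le> m \<and> (i = j \<or> even i \<and> (j = i + 1 \<or> i = j + 1))},
     Dom = fst, Cod = snd, Id = (\<lambda>i. (i, i)), Comp = (\<lambda>g f. (fst f, snd g))\<rparr>"

definition slice ::
  "nat \<Rightarrow> ('o \<times> nat, 'm \<times> (nat \<times> nat), 'p, 'n) cat_map \<Rightarrow> nat \<Rightarrow> ('o, 'm, 'p, 'n) cat_map" where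
  "slice m H j = \<lparr>fobj = (\<lambda>x. fobj H (x, j)), fmor = (\<lambda>f. fmor H (f, Id (zigzag m) j))\<rparr>"

definition homotopic_functors ::
  "('o, 'm) cat \<Rightarrow> ('p, 'n) cat \<Rightarrow>
   ('o, 'm, 'p, 'n) cat_map \<Rightarrow> ('o, 'm, 'p, 'n) cat_map \<Rightarrow> bool" where
  "homotopic_functors C D F G \<longleftrightarrow> cat_functor C D F \<and> cat_functor C D G \<and>
     (\<exists>m H. cat_functor (product_cat C (zigzag m)) D H \<and>
        functor_eq C (slice m H 0) F \<and> functor_eq C (slice m H m) G)"


subsection \<open>Geometric covers\<close>

definition subcategory :: "('o, 'm) cat \<Rightarrow> ('o, 'm) cat \<Rightarrow> bool" where
  "subcategory U B \<longleftrightarrow> category U \<and> category B \<and> Obj U \<subseteq> Obj B \<and> Mor U \<subseteq> Mor B \<and>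
     (\<forall>f\<in>Mor U. Dom U f = Dom B f \<and> Cod U f = Cod B f) \<and>
     (\<forall>x\<in>Obj U. Id U x = Id B x) \<and>
     (\<forall>f\<in>Mor U. \<forall>g\<in>Mor U. Cod U f = Dom U g \<longrightarrow> Comp U g f = Comp B g f)"

definition inclusion :: "('o, 'm, 'o, 'm) cat_map" where
  "inclusion = \<lparr>fobj = id, fmor = id\<rparr>"

text \<open>
  Chains of positive length are nonempty lists of morphisms, written in the order in which
  they are composed; chains of length zero are objects and are treated separately.
\<close>

definition mor_chain :: "('o, 'm) cat \<Rightarrow> 'm list \<Rightarrow> bool" where
  "mor_chain C fs \<longleftrightarrow> fs \<noteq> [] \<and> set fs \<subseteq> Mor C \<and> successively (\<lambda>f g. Cod C f = Dom C g) fs"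

definition geometric_cover :: "('o, 'm) cat \<Rightarrow> nat \<Rightarrow> (nat \<Rightarrow> ('o, 'm) cat) \<Rightarrow> bool" where
  "geometric_cover B n U \<longleftrightarrow> (\<forall>i\<le>n. subcategory (U i) B) \<and>
     (\<forall>x\<in>Obj B. \<exists>i\<le>n. x \<in> Obj (U i)) \<and>
     (\<forall>fs. mor_chain B fs \<longrightarrow> (\<exists>i\<le>n. mor_chain (U i) fs))"


subsection \<open>Sectional number and Svarc genus\<close>

text \<open>The infimum of the empty set of extended naturals is \<open>\<infinity>\<close>.\<close>

definition sectional_number ::
  "('e, 'f) cat \<Rightarrow> ('b, 'g) cat \<Rightarrow> ('e, 'f, 'b, 'g) cat_map \<Rightarrow> enat" where
  "sectional_number E B P = Inf {enat n | n. \<exists>U. geometric_cover B n U \<and>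
     (\<exists>s. \<forall>i\<le>n. cat_functor (U i) E (s i) \<and>
        functor_eq (U i) (functor_comp P (s i)) inclusion)}"

definition svarc_genus ::
  "('e, 'f) cat \<Rightarrow> ('b, 'g) cat \<Rightarrow> ('e, 'f, 'b, 'g) cat_map \<Rightarrow> enat" where
  "svarc_genus E B P = Inf {enat n | n. \<exists>U. geometric_cover B n U \<and>
     (\<exists>s. \<forall>i\<le>n. cat_functor (U i) E (s i) \<and>
        homotopic_functors (U i) B (functor_comp P (s i)) inclusion)}"


subsection \<open>Well-definedness\<close>

lemma category_opposite: "category C \<Longrightarrow> category (opposite C)"
  unfolding category_def opposite_def Hom_def by auto

lemma category_zigzag: "category (zigzag m)"
  unfolding category_def zigzag_def Hom_def by auto

lemma category_product_cat:
  assumes "category C" "category D"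
  shows "category (product_cat C D)"
  using assms unfolding category_def product_cat_def Hom_def by (auto simp: map_prod_def)

lemma cat_functor_comp:
  assumes "cat_functor C D F" "cat_functor D E G"
  shows "cat_functor C E (functor_comp G F)"
  using assms unfolding cat_functor_def cat_functor_axioms_def functor_comp_def
  by (auto, metis+)

lemma cat_functor_inclusion:
  assumes "subcategory U B"
  shows "cat_functor U B inclusion"
  using assms
  unfolding subcategory_def cat_functor_def cat_functor_axioms_def inclusion_def Hom_def
  by auto

end

theory Submission
  imports Defs
begin

text \<open>
  A homotopy from \<open>P \<circ> s\<close> to the inclusion is a zigzag of natural transformations. A natural
  transformation into \<open>P \<circ> s\<close> is lifted objectwise to Cartesian arrows with codomain \<open>s x\<close>;
  their universal property makes the domains of these arrows the values of a functor that lies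
  strictly over the source of the transformation. Transformations out of \<open>P \<circ> s\<close> are handled
  dually with op-Cartesian arrows. Going along the zigzag turns a section up to homotopy into a
  strict section on the same subcategory.
\<close>

section \<open>Opposite categories and hom-sets\<close>

lemma opposite_opposite [simp]: "opposite (opposite C) = C"
  by (simp add: opposite_def)

lemma Hom_opposite [simp]: "Hom (opposite C) x y = Hom C y x"
  by (auto simp: opposite_def Hom_def)

lemma Obj_opposite [simp]: "Obj (opposite C) = Obj C"
  and Mor_opposite [simp]: "Mor (opposite C) = Mor C"
  and Id_opposite [simp]: "Id (opposite C) = Id C"
  and Comp_opposite [simp]: "Comp (opposite C) g f = Comp C f g"
  by (simp_all add: opposite_def)

lemma cat_functor_opposite:
  assumes "cat_functor C D F"
  shows "cat_functor (opposite C) (opposite D) F"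
proof -
  interpret cat_functor C D F by fact
  show ?thesis
    by (intro cat_functor.intro cat_functor_axioms.intro category_opposite
        source.category_axioms target.category_axioms)
      (simp_all add: fobj_in fmor_in fmor_Id fmor_Comp)
qed

lemma functor_eq_opposite [simp]: "functor_eq (opposite C) F G \<longleftrightarrow> functor_eq C F G"
  by (simp add: functor_eq_def)

lemma (in category) HomI: "f \<in> Mor C \<Longrightarrow> f \<in> Hom C (Dom C f) (Cod C f)"
  by (simp add: Hom_def)

lemma (in category) Hom_Obj: "f \<in> Hom C x y \<Longrightarrow> x \<in> Obj C \<and> y \<in> Obj C"
  using Dom_in Cod_in by (auto simp: Hom_def)

section \<open>Lifting natural transformations along a fibration or op-fibration\<close>

lemma cartesianD:
  assumes "cartesian E B P \<phi>" "\<phi> \<in> Hom E d c" "e \<in> Obj E" "\<beta> \<in> Hom E e c"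
    "a \<in> Hom B (fobj P e) (fobj P d)" "Comp B (fmor P \<phi>) a = fmor P \<beta>"
  shows "\<exists>!\<alpha>. \<alpha> \<in> Hom E e d \<and> Comp E \<phi> \<alpha> = \<beta> \<and> fmor P \<alpha> = a"
proof -
  have "Dom E \<phi> = d" "Cod E \<phi> = c"
    using assms(2) by (auto simp: Hom_def)
  then show ?thesis
    using assms unfolding cartesian_def by blast
qed

text \<open>The family \<open>t\<close> is a natural transformation from \<open>G\<close> to
  \<open>P\<close> after \<open>s\<close>. Once a Cartesian lift is chosen over each component, the
  action on morphisms is forced, so no compatibility (cleavage) between the choices is needed:
  functoriality follows from uniqueness of factorizations.\<close>

lemma fibration_lift_transformation:
  assumes fib: "fibration E B P" and s: "cat_functor U E s" and G: "cat_functor U B G"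
    and t: "\<And>x. x \<in> Obj U \<Longrightarrow> t x \<in> Hom B (fobj G x) (fobj P (fobj s x))"
    and natural: "\<And>f x y. f \<in> Hom U x y \<Longrightarrow>
      Comp B (t y) (fmor G f) = Comp B (fmor P (fmor s f)) (t x)"
  shows "\<exists>s'. cat_functor U E s' \<and> functor_eq U (functor_comp P s') G"
proof -
  interpret P: cat_functor E B P using fib by (simp add: fibration_def)
  interpret s: cat_functor U E s by fact
  interpret G: cat_functor U B G by fact
  have "\<exists>d \<phi>. d \<in> Obj E \<and> \<phi> \<in> Hom E d (fobj s x) \<and> cartesian E B P \<phi> \<and> fmor P \<phi> = t x"
    if x: "x \<in> Obj U" for x
    using fib t[OF x] G.fobj_in[OF x] P.fobj_in[OF s.fobj_in[OF x]] s.fobj_in[OF x]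
    unfolding fibration_def by blast
  then obtain d \<phi> where lift: "\<And>x. x \<in> Obj U \<Longrightarrow>
      d x \<in> Obj E \<and> \<phi> x \<in> Hom E (d x) (fobj s x) \<and> cartesian E B P (\<phi> x) \<and> fmor P (\<phi> x) = t x"
    by metis
  \<comment> \<open>The lifting property of a fibration fixes only the image of the arrow
    \<open>\<phi> x\<close>; the image of its domain is read off from the domain of
    \<open>t x\<close>.\<close>
  have Pd: "fobj P (d x) = fobj G x" if "x \<in> Obj U" for x
    using lift[OF that] t[OF that] P.fmor_in[of "\<phi> x" "d x" "fobj s x"] by (auto simp: Hom_def)
  \<comment> \<open>Here \<open>g\<close> and \<open>a\<close> stand for \<open>fmor s f\<close> and
    \<open>fmor G f\<close>: \<open>\<alpha>\<close> completes the square with vertical sides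
    \<open>\<phi> x\<close>, \<open>\<phi> y\<close> and lower side \<open>g\<close>, and lies over
    \<open>a\<close>.\<close>
  define lifts where "lifts x y g a \<alpha> \<longleftrightarrow>
      \<alpha> \<in> Hom E (d x) (d y) \<and> Comp E (\<phi> y) \<alpha> = Comp E g (\<phi> x) \<and> fmor P \<alpha> = a" for x y g a \<alpha>
  have ex1: "\<exists>!\<alpha>. lifts x y (fmor s f) (fmor G f) \<alpha>" if f: "f \<in> Hom U x y" for f x y
  proof -
    from f have xy: "x \<in> Obj U" "y \<in> Obj U" using s.source.Hom_Obj by blast+
    have sf: "fmor s f \<in> Hom E (fobj s x) (fobj s y)" using f by (rule s.fmor_in)
    have \<phi>x: "\<phi> x \<in> Hom E (d x) (fobj s x)" and \<phi>y: "\<phi> y \<in> Hom E (d y) (fobj s y)"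
      using lift xy by blast+
    \<comment> \<open>Naturality of \<open>t\<close> at \<open>f\<close> is the equation in the base
      required by the Cartesian property of \<open>\<phi> y\<close>.\<close>
    have "Comp B (fmor P (\<phi> y)) (fmor G f) = fmor P (Comp E (fmor s f) (\<phi> x))"
      using natural[OF f] lift xy P.fmor_Comp[OF \<phi>x sf] by simp
    moreover have "fmor G f \<in> Hom B (fobj P (d x)) (fobj P (d y))"
      using G.fmor_in[OF f] Pd xy by simp
    moreover have "Comp E (fmor s f) (\<phi> x) \<in> Hom E (d x) (fobj s y)"
      using \<phi>x sf by (rule P.source.Comp_in)
    ultimately show ?thesis
      using cartesianD[of E B P "\<phi> y" "d y" "fobj s y" "d x"] lift xy \<phi>y
      unfolding lifts_def by blast
  qed
  define \<sigma> where "\<sigma> f = (THE \<alpha>. lifts (Dom U f) (Cod U f) (fmor s f) (fmor G f) \<alpha>)" for f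
  have \<sigma>: "lifts x y (fmor s f) (fmor G f) (\<sigma> f)" if "f \<in> Hom U x y" for f x y
    using theI'[OF ex1[OF that]] that by (simp add: \<sigma>_def Hom_def)
  \<comment> \<open>From here on, \<open>\<sigma>\<close> of an identity or a composite is computed
    by exhibiting some arrow that satisfies \<open>lifts\<close>.\<close>
  have \<sigma>_eq: "\<sigma> f = \<alpha>" if "f \<in> Hom U x y" "lifts x y (fmor s f) (fmor G f) \<alpha>" for f x y \<alpha>
    using ex1[OF that(1)] \<sigma>[OF that(1)] that(2) by blast
  define s' where "s' = \<lparr>fobj = d, fmor = \<sigma>\<rparr>"
  have "cat_functor U E s'"
  proof
    show "fobj s' x \<in> Obj E" if "x \<in> Obj U" for x
      using lift[OF that] by (simp add: s'_def)
    show "fmor s' f \<in> Hom E (fobj s' x) (fobj s' y)" if "f \<in> Hom U x y" for f x y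
      using \<sigma>[OF that] by (simp add: s'_def lifts_def)
    show "fmor s' (Id U x) = Id E (fobj s' x)" if x: "x \<in> Obj U" for x
    proof -
      have \<phi>x: "\<phi> x \<in> Hom E (d x) (fobj s x)" and dx: "d x \<in> Obj E" using lift[OF x] by auto
      have "lifts x x (fmor s (Id U x)) (fmor G (Id U x)) (Id E (d x))"
        using P.source.Id_in[OF dx] P.source.Comp_Id_right[OF \<phi>x] P.source.Comp_Id_left[OF \<phi>x]
          P.fmor_Id[OF dx] s.fmor_Id[OF x] G.fmor_Id[OF x] Pd[OF x]
        by (simp add: lifts_def)
      then show ?thesis
        using \<sigma>_eq[OF s.source.Id_in[OF x]] by (simp add: s'_def)
    qed
    show "fmor s' (Comp U g f) = Comp E (fmor s' g) (fmor s' f)"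
      if f: "f \<in> Hom U x y" and g: "g \<in> Hom U y z" for f g x y z
    proof -
      have \<phi>: "\<phi> x \<in> Hom E (d x) (fobj s x)" "\<phi> y \<in> Hom E (d y) (fobj s y)"
        "\<phi> z \<in> Hom E (d z) (fobj s z)"
        using lift f g s.source.Hom_Obj by blast+
      have \<sigma>f: "\<sigma> f \<in> Hom E (d x) (d y)" "Comp E (\<phi> y) (\<sigma> f) = Comp E (fmor s f) (\<phi> x)"
        "fmor P (\<sigma> f) = fmor G f"
        using \<sigma>[OF f] by (simp_all add: lifts_def)
      have \<sigma>g: "\<sigma> g \<in> Hom E (d y) (d z)" "Comp E (\<phi> z) (\<sigma> g) = Comp E (fmor s g) (\<phi> y)"
        "fmor P (\<sigma> g) = fmor G g"
        using \<sigma>[OF g] by (simp_all add: lifts_def)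
      note sf = s.fmor_in[OF f] and sg = s.fmor_in[OF g]
      \<comment> \<open>Pasting the squares of \<open>f\<close> and \<open>g\<close> along
        \<open>\<phi> y\<close> gives the square of the composite.\<close>
      have "Comp E (\<phi> z) (Comp E (\<sigma> g) (\<sigma> f)) = Comp E (Comp E (fmor s g) (\<phi> y)) (\<sigma> f)"
        using P.source.Comp_assoc[OF \<sigma>f(1) \<sigma>g(1) \<phi>(3)] \<sigma>g(2) by simp
      also have "\<dots> = Comp E (fmor s g) (Comp E (fmor s f) (\<phi> x))"
        using P.source.Comp_assoc[OF \<sigma>f(1) \<phi>(2) sg] \<sigma>f(2) by simp
      also have "\<dots> = Comp E (fmor s (Comp U g f)) (\<phi> x)"
        using P.source.Comp_assoc[OF \<phi>(1) sf sg] s.fmor_Comp[OF f g] by simp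
      finally have "lifts x z (fmor s (Comp U g f)) (fmor G (Comp U g f)) (Comp E (\<sigma> g) (\<sigma> f))"
        using P.source.Comp_in[OF \<sigma>f(1) \<sigma>g(1)] P.fmor_Comp[OF \<sigma>f(1) \<sigma>g(1)] \<sigma>f(3) \<sigma>g(3)
          G.fmor_Comp[OF f g] by (simp add: lifts_def)
      then show ?thesis
        using \<sigma>_eq[OF s.source.Comp_in[OF f g]] by (simp add: s'_def)
    qed
  qed
  moreover have "functor_eq U (functor_comp P s') G"
    using Pd \<sigma>[OF s.source.HomI] by (simp add: functor_eq_def functor_comp_def s'_def lifts_def)
  ultimately show ?thesis by blast
qed

text \<open>Dual case: in the opposite categories \<open>t\<close> points from \<open>G\<close> to
  \<open>P\<close> after \<open>s\<close>, and its naturality squares are the same equations with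
  reversed composition. As \<open>opposite\<close> is involutive, the functor obtained there is also
  one from \<open>U\<close> to \<open>E\<close>.\<close>

lemma op_fibration_lift_transformation:
  assumes "op_fibration E B P" "cat_functor U E s" "cat_functor U B G"
    and "\<And>x. x \<in> Obj U \<Longrightarrow> t x \<in> Hom B (fobj P (fobj s x)) (fobj G x)"
    and "\<And>f x y. f \<in> Hom U x y \<Longrightarrow>
      Comp B (t y) (fmor P (fmor s f)) = Comp B (fmor G f) (t x)"
  shows "\<exists>s'. cat_functor U E s' \<and> functor_eq U (functor_comp P s') G"
proof -
  have "\<exists>s'. cat_functor (opposite U) (opposite E) s'
      \<and> functor_eq (opposite U) (functor_comp P s') G"
    using assms cat_functor_opposite[OF assms(2)] cat_functor_opposite[OF assms(3)]
    \<comment> \<open>The conclusion of the rule mentions none of \<open>t\<close>, \<open>s\<close>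
      and the base category, so unification cannot find them.\<close>
    by (intro fibration_lift_transformation[where t = t and s = s and B = "opposite B"])
      (auto simp: op_fibration_def)
  then show ?thesis
    using cat_functor_opposite[of "opposite U" "opposite E"] by auto
qed

section \<open>Homotopies as zigzags of natural transformations, and their lifting\<close>

lemma Hom_product_zigzag:
  assumes "f \<in> Hom U x y" "(i, j) \<in> Mor (zigzag m)"
  shows "(f, (i, j)) \<in> Hom (product_cat U (zigzag m)) (x, i) (y, j)"
  using assms by (auto simp: Hom_def product_cat_def zigzag_def)

lemma homotopy_slice:
  assumes "cat_functor (product_cat U (zigzag m)) D H" "category U" "j \<le> m"
  shows "cat_functor U D (slice m H j)"
proof -
  interpret H: cat_functor "product_cat U (zigzag m)" D H by fact
  interpret U: category U by fact
  have j: "(j, j) \<in> Mor (zigzag m)" using assms(3) by (simp add: zigzag_def)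
  show ?thesis
  proof
    show "fobj (slice m H j) x \<in> Obj D" if "x \<in> Obj U" for x
      using H.fobj_in[of "(x, j)"] that assms(3)
      by (simp add: slice_def product_cat_def zigzag_def)
    show "fmor (slice m H j) f \<in> Hom D (fobj (slice m H j) x) (fobj (slice m H j) y)"
      if "f \<in> Hom U x y" for f x y
      using H.fmor_in[OF Hom_product_zigzag[OF that j]] by (simp add: slice_def zigzag_def)
    show "fmor (slice m H j) (Id U x) = Id D (fobj (slice m H j) x)" if "x \<in> Obj U" for x
      using H.fmor_Id[of "(x, j)"] that assms(3)
      by (simp add: slice_def product_cat_def zigzag_def)
    show "fmor (slice m H j) (Comp U g f) = Comp D (fmor (slice m H j) g) (fmor (slice m H j) f)"
      if "f \<in> Hom U x y" "g \<in> Hom U y z" for f g x y z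
      using H.fmor_Comp[OF Hom_product_zigzag[OF that(1) j] Hom_product_zigzag[OF that(2) j]]
      by (simp add: slice_def product_cat_def zigzag_def)
  qed
qed

text \<open>Naturality holds because \<open>(f, (i, j))\<close> factors in two ways in the product:
  move along \<open>f\<close> first and then along the zigzag arrow, or the other way round.\<close>

lemma homotopy_transformation:
  assumes "cat_functor (product_cat U (zigzag m)) D H" "category U" "(i, j) \<in> Mor (zigzag m)"
  defines "t \<equiv> \<lambda>x. fmor H (Id U x, (i, j))"
  shows "x \<in> Obj U \<Longrightarrow> t x \<in> Hom D (fobj (slice m H i) x) (fobj (slice m H j) x)"
    and "f \<in> Hom U x y \<Longrightarrow>
      Comp D (t y) (fmor (slice m H i) f) = Comp D (fmor (slice m H j) f) (t x)"
proof -
  interpret H: cat_functor "product_cat U (zigzag m)" D H by fact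
  interpret U: category U by fact
  show "t x \<in> Hom D (fobj (slice m H i) x) (fobj (slice m H j) x)" if "x \<in> Obj U"
    using H.fmor_in[OF Hom_product_zigzag[OF U.Id_in[OF that] assms(3)]]
    by (simp add: t_def slice_def)
  show "Comp D (t y) (fmor (slice m H i) f) = Comp D (fmor (slice m H j) f) (t x)"
    if f: "f \<in> Hom U x y"
  proof -
    from f have xy: "x \<in> Obj U" "y \<in> Obj U" using U.Hom_Obj by blast+
    have ij: "(i, i) \<in> Mor (zigzag m)" "(j, j) \<in> Mor (zigzag m)"
      using assms(3) by (auto simp: zigzag_def)
    note k = Hom_product_zigzag
    have "Comp D (t y) (fmor (slice m H i) f) = fmor H (f, (i, j))"
      using H.fmor_Comp[OF k[OF f ij(1)] k[OF U.Id_in[OF xy(2)] assms(3)]] U.Comp_Id_left[OF f]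
      by (simp add: t_def slice_def product_cat_def zigzag_def)
    also have "\<dots> = Comp D (fmor (slice m H j) f) (t x)"
      using H.fmor_Comp[OF k[OF U.Id_in[OF xy(1)] assms(3)] k[OF f ij(2)]] U.Comp_Id_right[OF f]
      by (simp add: t_def slice_def product_cat_def zigzag_def)
    finally show ?thesis .
  qed
qed

text \<open>Induction along the zigzag, replacing the functor to \<open>E\<close> at each step while
  \<open>U\<close> stays fixed. The parity of \<open>j\<close> gives the direction of the next arrow
  and hence which half of the bifibration hypothesis applies.\<close>

lemma bifibration_lift_homotopy:
  assumes "bifibration E B P" and H: "cat_functor (product_cat U (zigzag m)) B H"
    and "cat_functor U E s" "functor_eq U (functor_comp P s) (slice m H 0)" "j \<le> m"
  shows "\<exists>s'. cat_functor U E s' \<and> functor_eq U (functor_comp P s') (slice m H j)"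
  using \<open>j \<le> m\<close>
proof (induction j)
  case 0
  then show ?case using assms by blast
next
  case (Suc j)
  then obtain s' where s': "cat_functor U E s'"
    and eq: "functor_eq U (functor_comp P s') (slice m H j)" by auto
  have U: "category U" using s' by (simp add: cat_functor_def)
  have eqs: "fobj (slice m H j) x = fobj P (fobj s' x)" if "x \<in> Obj U" for x
    using eq that by (simp add: functor_eq_def functor_comp_def)
  have eqs': "fmor (slice m H j) f = fmor P (fmor s' f)" if "f \<in> Hom U x y" for f x y
    using eq that by (simp add: functor_eq_def functor_comp_def Hom_def)
  have G: "cat_functor U B (slice m H (Suc j))"
    using H U Suc.prems by (rule homotopy_slice)
  show ?case
  proof (cases "even j")
    case True
    \<comment> \<open>The arrow leaves \<open>j\<close>, so the transformation starts at
      \<open>P\<close> after \<open>s'\<close> and is lifted by op-Cartesian arrows.\<close>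
    with Suc.prems have ar: "(j, Suc j) \<in> Mor (zigzag m)" by (simp add: zigzag_def)
    have "op_fibration E B P" using assms(1) by (simp add: bifibration_def)
    then show ?thesis using s' G
    proof (rule op_fibration_lift_transformation)
      show "fmor H (Id U x, (j, Suc j)) \<in> Hom B (fobj P (fobj s' x)) (fobj (slice m H (Suc j)) x)"
        if "x \<in> Obj U" for x
        using homotopy_transformation(1)[OF H U ar that] eqs[OF that] by simp
      show "Comp B (fmor H (Id U y, (j, Suc j))) (fmor P (fmor s' f)) =
          Comp B (fmor (slice m H (Suc j)) f) (fmor H (Id U x, (j, Suc j)))"
        if "f \<in> Hom U x y" for f x y
        using homotopy_transformation(2)[OF H U ar that] eqs'[OF that] by simp
    qed
  next
    case False
    \<comment> \<open>The arrow enters \<open>j\<close>, so the transformation ends at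
      \<open>P\<close> after \<open>s'\<close> and is lifted by Cartesian arrows.\<close>
    with Suc.prems have ar: "(Suc j, j) \<in> Mor (zigzag m)" by (simp add: zigzag_def)
    have "fibration E B P" using assms(1) by (simp add: bifibration_def)
    then show ?thesis using s' G
    proof (rule fibration_lift_transformation)
      show "fmor H (Id U x, (Suc j, j)) \<in> Hom B (fobj (slice m H (Suc j)) x) (fobj P (fobj s' x))"
        if "x \<in> Obj U" for x
        using homotopy_transformation(1)[OF H U ar that] eqs[OF that] by simp
      show "Comp B (fmor H (Id U y, (Suc j, j))) (fmor (slice m H (Suc j)) f) =
          Comp B (fmor P (fmor s' f)) (fmor H (Id U x, (Suc j, j)))"
        if "f \<in> Hom U x y" for f x y
        using homotopy_transformation(2)[OF H U ar that] eqs'[OF that] by simp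
    qed
  qed
qed

lemma bifibration_lift_homotopic:
  assumes "bifibration E B P" "cat_functor U E s" "homotopic_functors U B (functor_comp P s) G"
  shows "\<exists>s'. cat_functor U E s' \<and> functor_eq U (functor_comp P s') G"
proof -
  obtain m H where H: "cat_functor (product_cat U (zigzag m)) B H"
    and "functor_eq U (slice m H 0) (functor_comp P s)" and Hm: "functor_eq U (slice m H m) G"
    using assms(3) by (auto simp: homotopic_functors_def)
  then have "functor_eq U (functor_comp P s) (slice m H 0)" by (simp add: functor_eq_def)
  then obtain s' where "cat_functor U E s'" "functor_eq U (functor_comp P s') (slice m H m)"
    using bifibration_lift_homotopy[OF assms(1) H assms(2) _ order_refl] by blast
  with Hm show ?thesis by (auto simp: functor_eq_def)
qed

text \<open>The constant homotopy with \<open>m = 0\<close>: its only slice agrees with both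
  functors on the carriers of \<open>C\<close>.\<close>

lemma homotopic_functors_if_functor_eq:
  fixes C :: "('a, 'b) cat" and D :: "('c, 'd) cat"
  assumes F: "cat_functor C D F" and G: "cat_functor C D G" and eq: "functor_eq C F G"
  shows "homotopic_functors C D F G"
proof -
  define H :: "('a \<times> nat, 'b \<times> nat \<times> nat, 'c, 'd) cat_map"
    where "H = functor_comp F \<lparr>fobj = fst, fmor = fst\<rparr>"
  have C: "category C" using F by (simp add: cat_functor_def)
  have "cat_functor (product_cat C (zigzag 0)) C \<lparr>fobj = fst, fmor = fst\<rparr>"
    by (intro cat_functor.intro cat_functor_axioms.intro category_product_cat category_zigzag C)
      (auto simp: product_cat_def Hom_def)
  then have "cat_functor (product_cat C (zigzag 0)) D H"
    unfolding H_def using F by (rule cat_functor_comp)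
  moreover have "functor_eq C (slice 0 H 0) F" "functor_eq C (slice 0 H 0) G"
    using eq by (simp_all add: functor_eq_def slice_def H_def functor_comp_def)
  ultimately show ?thesis
    using F G unfolding homotopic_functors_def by blast
qed

section \<open>Comparison of the two invariants\<close>

lemma homotopy_section_iff_section:
  assumes "bifibration E B P" "subcategory U B"
  shows "(\<exists>s. cat_functor U E s \<and> homotopic_functors U B (functor_comp P s) inclusion) \<longleftrightarrow>
    (\<exists>s. cat_functor U E s \<and> functor_eq U (functor_comp P s) inclusion)"
proof -
  \<comment> \<open>Since \<open>homotopic_functors\<close> demands functoriality at both ends,
    passing from a strict section to one up to homotopy uses that \<open>P\<close> after
    \<open>s\<close> and the inclusion are functors.\<close>
  have "cat_functor E B P" using assms(1) by (simp add: bifibration_def)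
  then show ?thesis
    using bifibration_lift_homotopic[OF assms(1)] homotopic_functors_if_functor_eq
      cat_functor_inclusion[OF assms(2)] cat_functor_comp by metis
qed

theorem proposition2p18:
  fixes E :: "('e, 'f) cat" and B :: "('b, 'g) cat" and P :: "('e, 'f, 'b, 'g) cat_map"
  assumes "bifibration E B P"
  shows "svarc_genus E B P = sectional_number E B P"
proof -
  have "(\<exists>s. \<forall>i\<le>n. cat_functor (U i) E (s i) \<and>
        homotopic_functors (U i) B (functor_comp P (s i)) inclusion) \<longleftrightarrow>
      (\<exists>s. \<forall>i\<le>n. cat_functor (U i) E (s i) \<and>
        functor_eq (U i) (functor_comp P (s i)) inclusion)"
    if "geometric_cover B n U" for n U
  proof -
    have "(\<exists>s. cat_functor (U i) E s \<and>
          homotopic_functors (U i) B (functor_comp P s) inclusion) \<longleftrightarrow>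
        (\<exists>s. cat_functor (U i) E s \<and> functor_eq (U i) (functor_comp P s) inclusion)"
      if "i \<le> n" for i
      using homotopy_section_iff_section[OF assms] \<open>geometric_cover B n U\<close> that
      by (simp add: geometric_cover_def)
    \<comment> \<open>The equivalence holds for each index separately; choice assembles the sections
      into a family \<open>s\<close>.\<close>
    then show ?thesis by metis
  qed
  then have "(\<lambda>n. \<exists>U. geometric_cover B n U \<and> (\<exists>s. \<forall>i\<le>n. cat_functor (U i) E (s i) \<and>
        homotopic_functors (U i) B (functor_comp P (s i)) inclusion)) =
      (\<lambda>n. \<exists>U. geometric_cover B n U \<and> (\<exists>s. \<forall>i\<le>n. cat_functor (U i) E (s i) \<and>
        functor_eq (U i) (functor_comp P (s i)) inclusion))"
    \<comment> \<open>The congruence rule makes the cover condition available while the second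
      conjunct is rewritten; the same covers thus serve both infima.\<close>
    by (simp cong: conj_cong)
  then show ?thesis
    unfolding svarc_genus_def sectional_number_def by (simp add: fun_eq_iff)
qed

end
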